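(* Let $\phi$ be a fermionic (odd) superfield and $L=(\mathcal{D}^3+\phi)(\mathcal{D}^3+\phi)$. Then for every positive integer $n$, $$\mathrm{sres}\,L^{\frac{n}{3}}\in\mathrm{Im}\,\mathcal{D},$$ i.e. the super residue of $L^{n/3}$ equals $(\mathcal{D}f)$ for some super differential polynomial $f$ in $\phi$.
   Context: Superspace has one even coordinate $x$ and one odd coordinate $\theta$; $\mathcal{D}=\partial_\theta+\theta\partial_x$ is the super derivative, so $\mathcal{D}^2=\partial_x$. Let $\mathcal{A}$ be the algebra of super differential polynomials in $\phi$: the free supercommutative algebra generated by $\mathcal{D}^k\phi$, $k\ge 0$, with $\phi$ odd (so $\mathcal{D}^k\phi$ has parity $k+1$ mod 2) and $\mathcal{D}$ acting as an odd derivation. $\mathrm{Im}\,\mathcal{D}$ is the image of $\mathcal{D}:\mathcal{A}\to\mathcal{A}$. Super pseudodifferential operators are formal series $\sum_{k\le N}a_k\mathcal{D}^k$ with $a_k\in\mathcal{A}$, composed using $\mathcal{D}a=(\mathcal{D}a)+(-1)^{|a|}a\mathcal{D}$. The super residue $\mathrm{sres}$ of $\sum a_k\mathcal{D}^k$ is the coefficient $a_{-1}$ of $\mathcal{D}^{-1}$. $L^{1/3}$ is the even operator with leading term $\partial_x=\mathcal{D}^2$, coefficients in $\mathcal{A}$, whose cube is $L$, and $L^{n/3}=(L^{1/3})^n$. *)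

theory Defs
  imports Complex_Main
begin

text \<open>
  The free supercommutative algebra over a field \<open>'k\<close> of characteristic zero on generators
  \<open>Gen k\<close>, which stand for the iterated super derivatives of the odd superfield
  \<open>\<phi>\<close>, is built as terms modulo the congruence \<open>sterm_eq\<close>. Its rules are the axioms
  of an associative unital \<open>'k\<close>-algebra and supercommutativity of the generators, the \<open>k\<close>-th
  one having parity \<open>k + 1\<close>. For \<open>i = j\<close> even the last rule gives \<open>x * x = - (x * x)\<close>,
  hence squares of odd generators vanish. Lemma \<open>sdp_universal\<close> below is the universal property.
\<close>

datatype 'k sterm =
    Const 'k
  | Gen nat
  | Add "'k sterm" "'k sterm"
  | Mul "'k sterm" "'k sterm"

inductive sterm_eq :: "'k::field_char_0 sterm \<Rightarrow> 'k sterm \<Rightarrow> bool" where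
  se_refl: "sterm_eq s s"
| se_sym: "sterm_eq s t \<Longrightarrow> sterm_eq t s"
| se_trans: "sterm_eq s t \<Longrightarrow> sterm_eq t u \<Longrightarrow> sterm_eq s u"
| se_Add_cong: "sterm_eq s s' \<Longrightarrow> sterm_eq t t' \<Longrightarrow> sterm_eq (Add s t) (Add s' t')"
| se_Mul_cong: "sterm_eq s s' \<Longrightarrow> sterm_eq t t' \<Longrightarrow> sterm_eq (Mul s t) (Mul s' t')"
| se_Add_assoc: "sterm_eq (Add (Add s t) u) (Add s (Add t u))"
| se_Add_comm: "sterm_eq (Add s t) (Add t s)"
| se_Add_zero: "sterm_eq (Add (Const 0) s) s"
| se_Mul_assoc: "sterm_eq (Mul (Mul s t) u) (Mul s (Mul t u))"
| se_Mul_one: "sterm_eq (Mul (Const 1) s) s"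
| se_Mul_zero: "sterm_eq (Mul (Const 0) s) (Const 0)"
| se_distrib_right: "sterm_eq (Mul (Add s t) u) (Add (Mul s u) (Mul t u))"
| se_distrib_left: "sterm_eq (Mul u (Add s t)) (Add (Mul u s) (Mul u t))"
| se_Const_Add: "sterm_eq (Const (a + b)) (Add (Const a) (Const b))"
| se_Const_Mul: "sterm_eq (Const (a * b)) (Mul (Const a) (Const b))"
| se_Const_central: "sterm_eq (Mul (Const a) s) (Mul s (Const a))"
| se_supercomm:
    "sterm_eq (Mul (Gen i) (Gen j)) (Mul (Const ((-1) ^ ((i + 1) * (j + 1)))) (Mul (Gen j) (Gen i)))"

quotient_type (overloaded) 'k sdp = "'k::field_char_0 sterm" / sterm_eq
  by (auto intro!: equivpI reflpI sympI transpI intro: sterm_eq.intros)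

lift_definition scal :: "'k::field_char_0 \<Rightarrow> 'k sdp" is Const .

text \<open>\<open>phi k\<close> is \<open>D^k \<phi>\<close>, so the superfield itself is \<open>phi 0\<close>.\<close>

lift_definition phi :: "nat \<Rightarrow> 'k::field_char_0 sdp" is Gen .

instantiation sdp :: (field_char_0) ring_1
begin

lift_definition zero_sdp :: "'a sdp" is "Const 0" .
lift_definition one_sdp :: "'a sdp" is "Const 1" .
lift_definition plus_sdp :: "'a sdp \<Rightarrow> 'a sdp \<Rightarrow> 'a sdp" is Add
  by (rule se_Add_cong)
lift_definition times_sdp :: "'a sdp \<Rightarrow> 'a sdp \<Rightarrow> 'a sdp" is Mul
  by (rule se_Mul_cong)
definition uminus_sdp :: "'a sdp \<Rightarrow> 'a sdp" where "uminus_sdp a = scal (-1) * a"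
definition minus_sdp :: "'a sdp \<Rightarrow> 'a sdp \<Rightarrow> 'a sdp" where "minus_sdp a b = a + - b"

instance
proof
  fix a b c :: "'a sdp"
  show "a + b + c = a + (b + c)" by transfer (rule se_Add_assoc)
  show "a + b = b + a" by transfer (rule se_Add_comm)
  show "0 + a = a" by transfer (rule se_Add_zero)
  show "a * b * c = a * (b * c)" by transfer (rule se_Mul_assoc)
  show one: "1 * a = a" by transfer (rule se_Mul_one)
  show "a * 1 = a" by transfer (meson se_Mul_one se_Const_central se_sym se_trans)
  show dist: "(a + b) * c = a * c + b * c" for a b c :: "'a sdp"
    by transfer (rule se_distrib_right)
  show "a * (b + c) = a * b + a * c" by transfer (rule se_distrib_left)
  show "a - b = a + - b" by (rule minus_sdp_def)
  have "scal (-1) + 1 = (0 :: 'a sdp)" 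
    by transfer (metis add.left_inverse se_Const_Add se_sym)
  moreover have "0 * a = 0" by transfer (rule se_Mul_zero)
  ultimately show "- a + a = 0"
    unfolding uminus_sdp_def using dist[of "scal (-1)" 1 a] one by simp
  have "sterm_eq (Const 0) (Const (1::'a)) \<Longrightarrow> False"
  proof -
    define ev where "ev = rec_sterm (\<lambda>c. c :: 'a) (\<lambda>k. 0) (\<lambda>_ _ a b. a + b) (\<lambda>_ _ a b. a * b)"
    have "sterm_eq s t \<Longrightarrow> ev s = ev t" for s t
      by (induction rule: sterm_eq.induct) (auto simp: ev_def algebra_simps)
    then show "sterm_eq (Const 0) (Const (1::'a)) \<Longrightarrow> False"
      by (force simp: ev_def)
  qed
  then show "(0 :: 'a sdp) \<noteq> 1" by transfer blast
qed

end

lemma scal_0 [simp]: "scal 0 = 0" and scal_1 [simp]: "scal 1 = 1"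
  by (transfer, rule se_refl)+

lemma scal_add: "scal (a + b) = scal a + scal b"
  by transfer (rule se_Const_Add)

lemma scal_mult: "scal (a * b) = scal a * scal b"
  by transfer (rule se_Const_Mul)

lemma scal_central: "scal c * a = a * scal c"
  by transfer (rule se_Const_central)

lemma scal_minus: "scal (- a) = - scal a"
  by (metis add.right_inverse minus_unique scal_0 scal_add)

lemma scal_power: "scal (a ^ n) = scal a ^ n"
  by (induction n) (simp_all add: scal_mult)

lemma phi_supercomm: "phi i * phi j = (-1) ^ ((i + 1) * (j + 1)) * (phi j * phi i)"
proof -
  have "phi i * phi j = scal ((-1) ^ ((i + 1) * (j + 1))) * (phi j * phi i)"
    by transfer (rule se_supercomm)
  then show ?thesis by (simp add: scal_power scal_minus)
qed

lemma sdp_induct [case_names scal phi add mult]: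
  assumes "\<And>c. P (scal c)" "\<And>k. P (phi k)"
    and "\<And>a b. P a \<Longrightarrow> P b \<Longrightarrow> P (a + b)" "\<And>a b. P a \<Longrightarrow> P b \<Longrightarrow> P (a * b)"
  shows "P a"
proof -
  have "P (abs_sdp t)" for t
    by (induction t) (use assms in \<open>simp_all flip: scal.abs_eq phi.abs_eq plus_sdp.abs_eq times_sdp.abs_eq\<close>)
  then show ?thesis by (metis Quotient_abs_rep[OF Quotient_sdp])
qed

primrec eval_sterm :: "('k \<Rightarrow> 'b) \<Rightarrow> (nat \<Rightarrow> 'b) \<Rightarrow> 'k sterm \<Rightarrow> 'b::ring_1" where
  "eval_sterm h g (Const c) = h c"
| "eval_sterm h g (Gen k) = g k"
| "eval_sterm h g (Add s t) = eval_sterm h g s + eval_sterm h g t"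
| "eval_sterm h g (Mul s t) = eval_sterm h g s * eval_sterm h g t"

lemma eval_sterm_cong:
  fixes h :: "'k::field_char_0 \<Rightarrow> 'b::ring_1"
  assumes "sterm_eq s t"
    and h: "h 1 = 1" "\<And>a b. h (a + b) = h a + h b" "\<And>a b. h (a * b) = h a * h b"
    and central: "\<And>c x. h c * x = x * h c"
    and g: "\<And>i j. g i * g j = (-1) ^ ((i + 1) * (j + 1)) * (g j * g i)"
  shows "eval_sterm h g s = eval_sterm h g t"
proof -
  have h0: "h 0 = 0" using h(2)[of 0 0] by simp
  have hm: "h (-a) = - h a" for a
    by (metis add.right_inverse minus_unique h0 h(2))
  have hp: "h (a ^ n) = h a ^ n" for a n
    by (induction n) (simp_all add: h)
  show ?thesis using assms(1)
  proof (induction rule: sterm_eq.induct)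
    case (se_supercomm i j)
    show ?case using g[of i j] by (simp add: hp hm h del: power_Suc)
  next
    case (se_Const_central a s)
    show ?case by (simp only: eval_sterm.simps) (rule central)
  qed (auto simp: h h0 algebra_simps)
qed

lemma sdp_universal:
  fixes h :: "'k::field_char_0 \<Rightarrow> 'b::ring_1"
  assumes h: "h 1 = 1" "\<And>a b. h (a + b) = h a + h b" "\<And>a b. h (a * b) = h a * h b"
    and central: "\<And>c x. h c * x = x * h c"
    and g: "\<And>i j. g i * g j = (-1) ^ ((i + 1) * (j + 1)) * (g j * g i)"
  shows "\<exists>!F :: 'k sdp \<Rightarrow> 'b. (\<forall>c. F (scal c) = h c) \<and> (\<forall>k. F (phi k) = g k) \<and>
    (\<forall>a b. F (a + b) = F a + F b) \<and> (\<forall>a b. F (a * b) = F a * F b)"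
proof (rule ex1I)
  define F where "F a = eval_sterm h g (rep_sdp a)" for a
  have F: "F (abs_sdp t) = eval_sterm h g t" for t
  proof -
    have "sterm_eq (rep_sdp (abs_sdp t)) t"
      by (simp add: Quotient_rep_abs[OF Quotient_sdp] se_refl)
    from eval_sterm_cong[OF this, of h g, OF assms] show ?thesis
      by (simp add: F_def)
  qed
  have "F (a + b) = F a + F b \<and> F (a * b) = F a * F b" for a b
    by (metis F eval_sterm.simps(3,4) plus_sdp.abs_eq times_sdp.abs_eq Quotient_abs_rep[OF Quotient_sdp])
  then show *: "(\<forall>c. F (scal c) = h c) \<and> (\<forall>k. F (phi k) = g k) \<and>
    (\<forall>a b. F (a + b) = F a + F b) \<and> (\<forall>a b. F (a * b) = F a * F b)"
    by (simp add: F scal.abs_eq phi.abs_eq)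
  fix G :: "'k sdp \<Rightarrow> 'b"
  assume "(\<forall>c. G (scal c) = h c) \<and> (\<forall>k. G (phi k) = g k) \<and>
    (\<forall>a b. G (a + b) = G a + G b) \<and> (\<forall>a b. G (a * b) = G a * G b)"
  then have "G a = F a" for a
    by (induction a rule: sdp_induct) (use * in simp_all)
  then show "G = F" by blast
qed

lemma ginv_respects:
  fixes s t :: "'k::field_char_0 sterm"
  assumes st: "sterm_eq s t"
  shows "eval_sterm scal (\<lambda>k. (-1) ^ (k + 1) * phi k) s =
         eval_sterm scal (\<lambda>k. (-1) ^ (k + 1) * (phi k :: 'k sdp)) t"
proof -
  have c: "(-1) ^ n * x = x * (-1 :: 'k sdp) ^ n" for n x
    by (induction n) (simp_all)
  have "(-1) ^ (i + 1) * phi i * ((-1) ^ (j + 1) * phi j) =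
       (-1) ^ ((i + 1) * (j + 1)) * ((-1) ^ (j + 1) * phi j * ((-1) ^ (i + 1) * (phi i::'k sdp)))" for i j
    using phi_supercomm[of i j, where ?'a = 'k] by (cases "even i"; cases "even j") auto
  note * = eval_sterm_cong[OF st, of scal "\<lambda>k. (-1) ^ (k + 1) * (phi k :: 'k sdp)",
      OF scal_1 scal_add scal_mult scal_central this]
  show ?thesis by (rule *)
qed

text \<open>
  The grade involution: \<open>a\<close> is sent to \<open>a\<close> if it is even and to \<open>-a\<close> if it is odd
  (lemma \<open>ginv_has_parity\<close>). It replaces the sign \<open>(-1)^|a|\<close>, which makes sense only for
  homogeneous \<open>a\<close>.
\<close>

definition ginv :: "'k::field_char_0 sdp \<Rightarrow> 'k sdp" where
  "ginv a = eval_sterm scal (\<lambda>k. (-1) ^ (k + 1) * phi k) (rep_sdp a)"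

lemma sterm_eq_rep_abs: "sterm_eq (rep_sdp (abs_sdp t)) t"
  by (simp add: Quotient_rep_abs[OF Quotient_sdp] se_refl)

lemma sdp_abs_cases: obtains t where "a = abs_sdp t"
  by (metis Quotient_abs_rep[OF Quotient_sdp])

lemma ginv_abs: "ginv (abs_sdp t) = eval_sterm scal (\<lambda>k. (-1) ^ (k + 1) * phi k) t"
  unfolding ginv_def by (rule ginv_respects[OF sterm_eq_rep_abs])

lemma ginv_simps [simp]:
  "ginv (scal c) = scal c"
  "ginv (phi k) = (-1) ^ (k + 1) * phi k"
  "ginv (a + b) = ginv a + ginv b"
  "ginv (a * b) = ginv a * ginv b"
proof -
  obtain s t where "a = abs_sdp s" "b = abs_sdp t"
    by (metis sdp_abs_cases)
  then show "ginv (a + b) = ginv a + ginv b" "ginv (a * b) = ginv a * ginv b"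
    by (simp_all add: plus_sdp.abs_eq times_sdp.abs_eq ginv_abs)
qed (simp_all add: scal.abs_eq phi.abs_eq ginv_abs)

lemma ginv_0 [simp]: "ginv 0 = 0" and ginv_1 [simp]: "ginv 1 = 1"
  using ginv_simps(1)[of 0] ginv_simps(1)[of 1] by (simp_all only: scal_0 scal_1)

lemma ginv_minus [simp]: "ginv (- a) = - ginv a"
  using ginv_simps(3)[of "-a" a] by (simp add: eq_neg_iff_add_eq_0 del: ginv_simps)

lemma ginv_diff [simp]: "ginv (a - b) = ginv a - ginv b"
  using ginv_simps(3)[of a "-b"] by (simp del: ginv_simps)

lemma ginv_power [simp]: "ginv (a ^ n) = ginv a ^ n"
  by (induction n) simp_all

primrec D_raw :: "'k::field_char_0 sterm \<Rightarrow> 'k sdp" where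
  "D_raw (Const c) = 0"
| "D_raw (Gen k) = phi (k + 1)"
| "D_raw (Add s t) = D_raw s + D_raw t"
| "D_raw (Mul s t) = D_raw s * abs_sdp t + ginv (abs_sdp s) * D_raw t"

lemma D_raw_respects:
  fixes s t :: "'k::field_char_0 sterm"
  assumes "sterm_eq s t"
  shows "D_raw s = D_raw t"
proof -
  show ?thesis using assms
  proof (induction rule: sterm_eq.induct)
    case (se_supercomm i j)
    have *: "abs_sdp (Gen k) = phi k" "abs_sdp (Const c) = scal c" for k and c :: 'k
      by (simp_all add: phi.abs_eq scal.abs_eq)
    have "phi (i+1) * phi j + (-1)^(i+1) * phi i * phi (j+1) =
       (-1) ^ ((i + 1) * (j + 1)) * (phi (j+1) * phi i + (-1)^(j+1) * phi j * (phi (i+1) :: 'k sdp))"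
      using phi_supercomm[of "i+1" j, where ?'a = 'k] phi_supercomm[of "i" "j+1", where ?'a = 'k]
      by (cases "even i"; cases "even j") auto
    then show ?case by (simp add: * scal_power scal_minus)
  next
    case (se_Mul_cong s s' t t')
    then have "abs_sdp s = abs_sdp s'" "abs_sdp t = abs_sdp t'" by (simp_all add: sdp.abs_eq_iff)
    with se_Mul_cong show ?case by simp
  next
    case (se_Mul_assoc s t u)
    show ?case by (simp add: algebra_simps flip: times_sdp.abs_eq)
  next
    case (se_distrib_right s t u)
    show ?case by (simp add: algebra_simps flip: plus_sdp.abs_eq)
  next
    case (se_distrib_left s t u)
    show ?case by (simp add: algebra_simps flip: plus_sdp.abs_eq)
  qed (simp_all add: add_ac scal_central flip: scal.abs_eq)
qed

definition superD :: "'k::field_char_0 sdp \<Rightarrow> 'k sdp" where "superD a = D_raw (rep_sdp a)"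

lemma superD_abs: "superD (abs_sdp t) = D_raw t"
  unfolding superD_def by (rule D_raw_respects[OF sterm_eq_rep_abs])

lemma superD_simps [simp]:
  "superD (scal c) = 0"
  "superD (phi k) = phi (k + 1)"
  "superD (a + b) = superD a + superD b"
  "superD (a * b) = superD a * b + ginv a * superD b"
proof -
  obtain s t where "a = abs_sdp s" "b = abs_sdp t"
    by (metis sdp_abs_cases)
  then show "superD (a + b) = superD a + superD b" "superD (a * b) = superD a * b + ginv a * superD b"
    by (simp_all add: plus_sdp.abs_eq times_sdp.abs_eq superD_abs)
qed (simp_all add: scal.abs_eq phi.abs_eq superD_abs)

lemma ginv_ginv [simp]: "ginv (ginv a) = a"
proof (induction a rule: sdp_induct)
  case (phi k)
  show ?case by (cases "even k") simp_all
qed simp_all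

lemma superD_0 [simp]: "superD 0 = 0" and superD_1 [simp]: "superD 1 = 0"
  using superD_simps(1)[of 0] superD_simps(1)[of 1] by (simp_all only: scal_0 scal_1)

lemma superD_minus [simp]: "superD (- a) = - superD a"
  using superD_simps(3)[of "-a" a] by (simp add: eq_neg_iff_add_eq_0 del: superD_simps)

lemma superD_diff [simp]: "superD (a - b) = superD a - superD b"
  using superD_simps(3)[of a "-b"] by (simp del: superD_simps)

lemma ginv_superD: "ginv (superD a) = - superD (ginv a)"
proof (induction a rule: sdp_induct)
  case (phi k)
  show ?case by (cases "even k") simp_all
qed (simp_all add: algebra_simps)

lemma ginv_sum: "ginv (\<Sum>i\<in>S. f i) = (\<Sum>i\<in>S. ginv (f i))"
  by (induction S rule: infinite_finite_induct) simp_all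

lemma superD_sum: "superD (\<Sum>i\<in>S. f i) = (\<Sum>i\<in>S. superD (f i))"
  by (induction S rule: infinite_finite_induct) simp_all

text \<open>
  Parities are truth values, \<open>True\<close> meaning odd; the parity of a product is the exclusive
  disjunction \<open>p \<noteq> q\<close>. The element 0 has both parities.
\<close>

inductive has_parity :: "bool \<Rightarrow> 'k::field_char_0 sdp \<Rightarrow> bool" where
  has_parity_scal: "has_parity False (scal c)"
| has_parity_phi: "has_parity (even k) (phi k)"
| has_parity_add: "has_parity p a \<Longrightarrow> has_parity p b \<Longrightarrow> has_parity p (a + b)"
| has_parity_mult: "has_parity p a \<Longrightarrow> has_parity q b \<Longrightarrow> has_parity (p \<noteq> q) (a * b)"

lemma ginv_has_parity: "has_parity p a \<Longrightarrow> ginv a = (if p then - a else a)"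
  by (induction rule: has_parity.induct) auto

lemma has_parity_uminus: "has_parity p a \<Longrightarrow> has_parity p (- a)"
  using has_parity_mult[OF has_parity_scal, of p a "-1"] by (simp add: scal_minus)

lemma has_parity_0: "has_parity p 0"
  using has_parity_mult[OF has_parity_scal[of 0] has_parity_phi[of 0]] has_parity_scal[of 0] by (cases p) auto

lemma has_parity_decomp: "\<exists>b c. a = b + c \<and> has_parity False b \<and> has_parity True c"
proof (induction a rule: sdp_induct)
  case (scal c)
  show ?case by (metis has_parity_scal has_parity_0 add.right_neutral)
next
  case (phi k)
  show ?case by (cases "even k") (metis (full_types) has_parity_phi has_parity_0 add.right_neutral add.left_neutral)+
next
  case (add a b)
  then obtain a0 a1 b0 b1 where *: "a = a0 + a1" "b = b0 + b1" "has_parity False a0" "has_parity True a1"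
    "has_parity False b0" "has_parity True b1" by blast
  then have "a + b = (a0 + b0) + (a1 + b1)" by (simp add: algebra_simps)
  with * show ?case by (blast intro: has_parity_add)
next
  case (mult a b)
  then obtain a0 a1 b0 b1 where *: "a = a0 + a1" "b = b0 + b1" "has_parity False a0" "has_parity True a1"
    "has_parity False b0" "has_parity True b1" by blast
  then have "a * b = (a0 * b0 + a1 * b1) + (a0 * b1 + a1 * b0)" by (simp add: algebra_simps)
  moreover have "has_parity False (a0 * b0 + a1 * b1)"
    using has_parity_mult[of False a0 False b0] has_parity_mult[of True a1 True b1] *
    by (auto intro: has_parity_add)
  moreover have "has_parity True (a0 * b1 + a1 * b0)"
    using has_parity_mult[of False a0 True b1] has_parity_mult[of True a1 False b0] *
    by (auto intro: has_parity_add)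
  ultimately show ?case by blast
qed

lemma scal_half: "a + a = 0 \<Longrightarrow> (a :: 'k::field_char_0 sdp) = 0"
proof -
  assume "a + a = 0"
  then have "scal (1/2) * ((1 + 1) * a) = 0" by (simp only: distrib_right mult_1_left mult_zero_right)
  moreover have "scal (1/2) * (1 + 1) = (1 :: 'k sdp)"
    by (simp flip: scal_1 scal_add scal_mult)
  ultimately show ?thesis by (simp flip: mult.assoc)
qed

lemma has_parity_iff_ginv: "has_parity p a \<longleftrightarrow> ginv a = (if p then - a else a)"
proof
  assume *: "ginv a = (if p then - a else a)"
  obtain b c where bc: "a = b + c" "has_parity False b" "has_parity True c" using has_parity_decomp by blast
  with * have "if p then b + b = 0 else c + c = 0"
    using ginv_has_parity[OF bc(2)] ginv_has_parity[OF bc(3)]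
    by (auto simp: algebra_simps eq_neg_iff_add_eq_0 split: if_splits)
  then show "has_parity p a" using bc scal_half[of b] scal_half[of c] by (auto split: if_splits)
qed (rule ginv_has_parity)


text \<open>
  \<open>Dpow n j b\<close> is the coefficient of \<open>D^(n-j)\<close> in the composition of \<open>D^n\<close> with
  multiplication by \<open>b\<close>, for every integer \<open>n\<close>. The formula follows from
  \<open>D b = (D b) + (-1)^|b| b D\<close> by writing \<open>n = 2 m\<close> or \<open>n = 2 m + 1\<close> and using the
  Leibniz rule for \<open>D^(2 m)\<close>, the \<open>m\<close>-th power of an even derivation. The recursion
  \<open>Dpow_step_Suc\<close>, the ring axioms for the operators and lemma \<open>Dop_commute\<close> confirm it.
\<close>

definition superbinom :: "int \<Rightarrow> nat \<Rightarrow> 'k::field_char_0" where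
  "superbinom n j = (if even n \<and> odd j then 0 else of_int (n div 2) gchoose (j div 2))"

definition Dpow :: "int \<Rightarrow> nat \<Rightarrow> 'k::field_char_0 sdp \<Rightarrow> 'k sdp" where
  "Dpow n j b = scal (superbinom n j) * (if even (n - int j) then (superD ^^ j) b else ginv ((superD ^^ j) b))"

lemma superD_funpow_add: "(superD ^^ j) (a + b) = (superD ^^ j) a + (superD ^^ j) b"
  by (induction j) simp_all

lemma Dpow_add: "Dpow n j (a + b) = Dpow n j a + Dpow n j b"
  by (simp add: Dpow_def superD_funpow_add distrib_left)

lemma Dpow_zero [simp]: "Dpow n j 0 = 0"
  using Dpow_add[of n j 0 0] by simp

lemma Dpow_minus: "Dpow n j (- a) = - Dpow n j a"
  using Dpow_add[of n j a "-a"] by (simp add: eq_neg_iff_add_eq_0 add.commute)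

lemma Dpow_sum: "Dpow n j (\<Sum>i\<in>S. f i) = (\<Sum>i\<in>S. Dpow n j (f i))"
  by (induction S rule: infinite_finite_induct) (simp_all add: Dpow_add)

lemma Dpow_exp_0: "Dpow 0 j b = (if j = 0 then b else 0)"
  by (cases "j = 0") (auto simp: Dpow_def superbinom_def gbinomial_0_left elim!: evenE)

lemma Dpow_one: "Dpow n j (1 :: 'k::field_char_0 sdp) = (if j = 0 then 1 else 0)"
proof -
  have "j > 0 \<Longrightarrow> (superD ^^ j) (1 :: 'k sdp) = 0" by (induction j) (auto, metis eq_id_iff funpow_0 gr0I superD_0 superD_1)
  then show ?thesis by (cases "j = 0") (auto simp: Dpow_def superbinom_def)
qed

lemma Dpow_step_0: "Dpow (n + 1) 0 c = ginv (Dpow n 0 c)"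
  by (auto simp: Dpow_def superbinom_def)

lemma Dpow_step_Suc:
  fixes c :: "'k::field_char_0 sdp"
  shows "Dpow (n + 1) (Suc p) c = ginv (Dpow n (Suc p) c) + superD (Dpow n p c)"
proof -
  obtain m r where n: "n = 2 * m + r" "r = 0 \<or> r = 1" 
    using div_mult_mod_eq[of n 2] by (metis mod_2_eq_odd mult.commute of_bool_def)
  obtain i s where p: "p = 2 * i + s" "s = 0 \<or> s = 1" 
    using div_mult_mod_eq[of p 2] by (metis mod_2_eq_odd mult.commute of_bool_def)
  have g: "scal (1 + of_int m gchoose Suc i) =
      (scal (of_int m gchoose i) + scal (of_int m gchoose Suc i) :: 'k sdp)"
    using gbinomial_Suc_Suc[of "of_int m :: 'k" i] by (simp add: add.commute scal_add)
  show ?thesis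
    using n(2) p(2) by (elim disjE)
      (simp_all add: n(1) p(1) Dpow_def superbinom_def ginv_superD add.assoc g distrib_right add.commute)
qed

lemma Dpow_assoc_aux:
  "(\<Sum>j\<le>P. Dpow n j b * Dpow (n + m - int j) (P - j) c) = (\<Sum>i\<le>P. Dpow n (P - i) (b * Dpow m i c))"
proof -
  define L R where "L n P = (\<Sum>j\<le>P. Dpow n j b * Dpow (n + m - int j) (P - j) c)" 
    and "R n P = (\<Sum>i\<le>P. Dpow n (P - i) (b * Dpow m i c))" for n P
  have R0: "R (n + 1) 0 = ginv (R n 0)" for n by (simp add: R_def Dpow_step_0)
  have L0: "L (n + 1) 0 = ginv (L n 0)" for n
    using Dpow_step_0[of "n+m" c] Dpow_step_0[of n b] by (simp add: L_def algebra_simps)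
  have RS: "R (n + 1) (Suc P) = ginv (R n (Suc P)) + superD (R n P)" for n P
    by (simp add: R_def Suc_diff_le Dpow_step_Suc Dpow_step_0 ginv_sum superD_sum sum.distrib
          del: ginv_simps(4) superD_simps(4))
  have LS: "L (n + 1) (Suc P) = ginv (L n (Suc P)) + superD (L n P)" for n P
  proof -
    have 1: "Dpow (n + 1 + m - int j) (P - j + 1) c = 
        ginv (Dpow (n + m - int j) (P - j + 1) c) + superD (Dpow (n + m - int j) (P - j) c)" for j
      using Dpow_step_Suc[of "n + m - int j" "P - j" c] by (simp add: algebra_simps)
    have 2: "Dpow (n + 1 + m - int (Suc P)) 0 c = ginv (Dpow (n + m - int (Suc P)) 0 c)"
      using Dpow_step_0[of "n + m - int (Suc P)" c] by (simp add: algebra_simps)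
    have "L (n + 1) (Suc P) = (\<Sum>j\<le>Suc P. ginv (Dpow n j b) * Dpow (n + 1 + m - int j) (Suc P - j) c) +
        (\<Sum>j\<le>P. superD (Dpow n j b) * Dpow (n + m - int j) (P - j) c)"
      unfolding L_def by (subst (1 2) sum.atMost_Suc_shift)
        (simp add: Dpow_step_0 Dpow_step_Suc Dpow_step_0[of n, unfolded add.commute[of n 1]]
          Dpow_step_Suc[of n, unfolded add.commute[of n 1]] algebra_simps sum.distrib)
    also have "(\<Sum>j\<le>Suc P. ginv (Dpow n j b) * Dpow (n + 1 + m - int j) (Suc P - j) c) =
       ginv (L n (Suc P)) + (\<Sum>j\<le>P. ginv (Dpow n j b) * superD (Dpow (n + m - int j) (P - j) c))"
    proof -
      have "(\<Sum>j\<le>P. ginv (Dpow n j b) * Dpow (n + 1 + m - int j) (Suc P - j) c) =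
         (\<Sum>j\<le>P. ginv (Dpow n j b) * ginv (Dpow (n + m - int j) (Suc P - j) c)) +
         (\<Sum>j\<le>P. ginv (Dpow n j b) * superD (Dpow (n + m - int j) (P - j) c))"
        unfolding sum.distrib[symmetric]
        by (intro sum.cong refl) (use 1 in \<open>simp add: Suc_diff_le distrib_left\<close>)
      then show ?thesis using 2 by (simp add: L_def ginv_sum algebra_simps)
    qed
    finally show ?thesis by (simp add: L_def superD_sum sum.distrib algebra_simps)
  qed
  have "\<forall>P. L n P = R n P"
  proof (induction n rule: int_induct[of _ 0])
    case base
    have "R 0 P = (\<Sum>i\<in>{P}. Dpow 0 (P - i) (b * Dpow m i c))" for P
      unfolding R_def by (intro sum.mono_neutral_right) (auto simp: Dpow_exp_0)
    moreover have "L 0 P = (\<Sum>j\<in>{0}. Dpow 0 j b * Dpow (0 + m - int j) (P - j) c)" for P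
      unfolding L_def by (intro sum.mono_neutral_right) (auto simp: Dpow_exp_0)
    ultimately show ?case by (simp add: Dpow_exp_0)
  next
    case (step1 n)
    have "L (n + 1) P = R (n + 1) P" for P
      by (cases P) (use step1 L0 R0 LS RS in simp_all)
    then show ?case by blast
  next
    case (step2 n)
    have "L (n - 1) P = R (n - 1) P" for P
    proof (induction P)
      case 0
      show ?case using step2 L0[of "n-1"] R0[of "n-1"] by simp (metis ginv_ginv)
    next
      case (Suc P)
      show ?case using step2 LS[of "n-1" P] RS[of "n-1" P] Suc by simp (metis ginv_ginv)
    qed
    then show ?case by blast
  qed
  then show ?thesis by (simp add: L_def R_def)
qed

lifting_forget sdp.lifting

text \<open>
  The operator with coefficient function \<open>a\<close> is the formal sum of the \<open>a k * D^k\<close>, with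
  coefficients on the left.
\<close>

typedef (overloaded) 'k spdo = "{a :: int \<Rightarrow> 'k::field_char_0 sdp. \<exists>N. \<forall>k>N. a k = 0}"
  morphisms coeff Abs_spdo
  by auto

setup_lifting type_definition_spdo

lemma spdo_eqI: "(\<And>k. coeff A k = coeff B k) \<Longrightarrow> A = B"
  by (metis coeff_inject ext)

definition order_le :: "'k::field_char_0 spdo \<Rightarrow> int \<Rightarrow> bool" where
  "order_le A N \<longleftrightarrow> (\<forall>k>N. coeff A k = 0)"

lemma order_le_ex: "\<exists>N. order_le A N"
  using coeff[of A] by (simp add: order_le_def)

lemma order_le_mono: "order_le A N \<Longrightarrow> N \<le> M \<Longrightarrow> order_le A M"
  by (simp add: order_le_def)

instantiation spdo :: (field_char_0) ab_group_add
begin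

lift_definition zero_spdo :: "'a spdo" is "\<lambda>_. 0" by simp
lift_definition plus_spdo :: "'a spdo \<Rightarrow> 'a spdo \<Rightarrow> 'a spdo" is "\<lambda>a b k. a k + b k"
proof -
  fix a b :: "int \<Rightarrow> 'a sdp"
  assume "\<exists>N. \<forall>k>N. a k = 0" "\<exists>N. \<forall>k>N. b k = 0"
  then obtain N M where "\<forall>k>N. a k = 0" "\<forall>k>M. b k = 0" by blast
  then show "\<exists>N. \<forall>k>N. a k + b k = 0" by (intro exI[of _ "max N M"]) simp
qed
lift_definition uminus_spdo :: "'a spdo \<Rightarrow> 'a spdo" is "\<lambda>a k. - a k" by simp
definition minus_spdo :: "'a spdo \<Rightarrow> 'a spdo \<Rightarrow> 'a spdo" where "minus_spdo A B = A + - B"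

instance
proof
  fix A B C :: "'a spdo"
  show "A + B + C = A + (B + C)" by transfer (simp add: add.assoc)
  show "A + B = B + A" by transfer (simp add: add.commute)
  show "0 + A = A" by transfer simp
  show "- A + A = 0" by transfer simp
  show "A - B = A + - B" by (rule minus_spdo_def)
qed

end

lemma coeff_add [simp]: "coeff (A + B) k = coeff A k + coeff B k"
  and coeff_0 [simp]: "coeff 0 k = 0"
  and coeff_uminus [simp]: "coeff (- A) k = - coeff A k"
  by (transfer, simp)+

lemma coeff_diff [simp]: "coeff (A - B) k = coeff A k - coeff B k"
  by (simp only: diff_conv_add_uminus coeff_add coeff_uminus)

text \<open>\<open>opterm a n\<close> is \<open>a * D^n\<close>; multiplication by \<open>a\<close> is \<open>opterm a 0\<close>.\<close>

lift_definition opterm :: "'k::field_char_0 sdp \<Rightarrow> int \<Rightarrow> 'k spdo" is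
  "\<lambda>a n k. if k = n then a else 0"
proof -
  fix a :: "'k sdp" and n :: int
  show "\<exists>N. \<forall>k>N. (if k = n then a else 0) = 0" by (rule exI[of _ n]) simp
qed

lemma coeff_opterm: "coeff (opterm a n) k = (if k = n then a else 0)"
  by transfer simp

lemma sum_pairs_box:
  fixes f :: "int \<Rightarrow> int \<Rightarrow> 'a::comm_monoid_add"
  assumes "\<And>n m. P n m \<Longrightarrow> f n m \<noteq> 0 \<Longrightarrow> n \<in> I \<and> m \<in> J" "finite I" "finite J"
    and "{(n, m). P n m} \<subseteq> I \<times> J"
  shows "(\<Sum>(n, m) \<in> {(n, m). P n m}. f n m) = (\<Sum>n\<in>I. \<Sum>m\<in>J. if P n m then f n m else 0)"
proof -
  have "(\<Sum>n\<in>I. \<Sum>m\<in>J. if P n m then f n m else 0) = (\<Sum>(n, m)\<in>I \<times> J. if P n m then f n m else 0)"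
    by (rule sum.cartesian_product)
  also have "\<dots> = (\<Sum>(n, m) \<in> {(n, m). P n m}. if P n m then f n m else 0)"
    by (rule sum.mono_neutral_right) (use assms in \<open>auto split: if_splits\<close>)
  finally show ?thesis by (auto intro!: sum.cong)
qed

lemma sum_rotate:
  "(\<Sum>a\<in>A. \<Sum>b\<in>B. \<Sum>c\<in>C. f a b c) = (\<Sum>c\<in>C. \<Sum>a\<in>A. \<Sum>b\<in>B. f a b c)"
proof -
  have "(\<Sum>a\<in>A. \<Sum>b\<in>B. \<Sum>c\<in>C. f a b c) = (\<Sum>a\<in>A. \<Sum>c\<in>C. \<Sum>b\<in>B. f a b c)"
    by (intro sum.cong refl sum.swap)
  also have "\<dots> = (\<Sum>c\<in>C. \<Sum>a\<in>A. \<Sum>b\<in>B. f a b c)" by (rule sum.swap)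
  finally show ?thesis .
qed

definition Dpow' :: "int \<Rightarrow> int \<Rightarrow> 'k::field_char_0 sdp \<Rightarrow> 'k sdp" where
  "Dpow' n j b = (if j < 0 then 0 else Dpow n (nat j) b)"

lemma mul_coeff_box:
  fixes a b :: "int \<Rightarrow> 'k::field_char_0 sdp"
  assumes "\<forall>n>N. a n = 0" "\<forall>m>M. b m = 0" "lN \<le> k - M" "lM \<le> k - N"
  shows "(\<Sum>(n, m) \<in> {(n, m). a n \<noteq> 0 \<and> b m \<noteq> 0 \<and> k \<le> n + m}. a n * Dpow n (nat (n + m - k)) (b m))
       = (\<Sum>n\<in>{lN..N}. \<Sum>m\<in>{lM..M}. a n * Dpow' n (n + m - k) (b m))"
proof -
  have *: "n \<in> {lN..N} \<and> m \<in> {lM..M}" if "a n \<noteq> 0 \<and> b m \<noteq> 0 \<and> k \<le> n + m" for n m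
  proof -
    have "n \<le> N" "m \<le> M" using that assms(1,2) by (meson not_le_imp_less)+
    then show ?thesis using that assms(3,4) by auto
  qed
  show ?thesis
    by (subst sum_pairs_box[of _ _ "{lN..N}" "{lM..M}"]) (use * in \<open>auto intro!: sum.cong simp: Dpow'_def\<close>)
qed

instantiation spdo :: (field_char_0) ring_1
begin

lift_definition one_spdo :: "'a spdo" is "\<lambda>k. if k = 0 then 1 else 0"
  by (rule exI[of _ 0]) simp

lift_definition times_spdo :: "'a spdo \<Rightarrow> 'a spdo \<Rightarrow> 'a spdo" is
  "\<lambda>a b k. \<Sum>(n, m) \<in> {(n, m). a n \<noteq> 0 \<and> b m \<noteq> 0 \<and> k \<le> n + m}.
     a n * Dpow n (nat (n + m - k)) (b m)"
proof -
  fix a b :: "int \<Rightarrow> 'a sdp"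
  assume "\<exists>N. \<forall>k>N. a k = 0" "\<exists>N. \<forall>k>N. b k = 0"
  then obtain N M where "\<forall>k>N. a k = 0" "\<forall>k>M. b k = 0" by blast
  then have *: "n \<le> N \<and> m \<le> M" if "a n \<noteq> 0 \<and> b m \<noteq> 0" for n m
    using that by (meson not_le_imp_less)
  have "{(n, m). a n \<noteq> 0 \<and> b m \<noteq> 0 \<and> k \<le> n + m} = {}" if "k > N + M" for k
    using * that by fastforce
  then show "\<exists>N. \<forall>k>N. (\<Sum>(n, m) \<in> {(n, m). a n \<noteq> 0 \<and> b m \<noteq> 0 \<and> k \<le> n + m}.
     a n * Dpow n (nat (n + m - k)) (b m)) = 0"
    by (intro exI[of _ "N + M"] allI impI) (simp only: sum.empty)
qed

lemma coeff_mult_box: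
  fixes A B :: "'a spdo"
  assumes "order_le A N" "order_le B M" "lN \<le> k - M" "lM \<le> k - N"
  shows "coeff (A * B) k = (\<Sum>n\<in>{lN..N}. \<Sum>m\<in>{lM..M}. coeff A n * Dpow' n (n + m - k) (coeff B m))"
  using mul_coeff_box[of N "coeff A" M "coeff B"] assms
  by (simp add: times_spdo.rep_eq order_le_def)

lemma Dpow'_add: "Dpow' n j (a + b) = Dpow' n j a + Dpow' n j b"
  by (simp add: Dpow'_def Dpow_add)

lemma Dpow'_sum: "Dpow' n j (\<Sum>i\<in>S. f i) = (\<Sum>i\<in>S. Dpow' n j (f i))"
  by (simp add: Dpow'_def Dpow_sum)

lemma order_le_mult: "order_le (A :: 'a spdo) N \<Longrightarrow> order_le B M \<Longrightarrow> order_le (A * B) (N + M)"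
  unfolding order_le_def[of "A * B"] by (auto simp: coeff_mult_box[of A N B M "k - M" k "k - N" for k])

lemma Dpow'_assoc:
  assumes "n \<le> N" "m \<le> M" "l \<le> L"
  shows "(\<Sum>q\<in>{k-L..N+M}. Dpow' n (n + m - q) b * Dpow' q (q + l - k) c) =
         (\<Sum>r\<in>{k-N..M+L}. Dpow' n (n + r - k) (b * Dpow' m (m + l - r) c))"
proof (cases "n + m + l - k < 0")
  case True
  then have "(\<Sum>q\<in>{k-L..N+M}. Dpow' n (n + m - q) b * Dpow' q (q + l - k) c) = 0"
    "(\<Sum>r\<in>{k-N..M+L}. Dpow' n (n + r - k) (b * Dpow' m (m + l - r) c)) = 0"
    by (auto simp: Dpow'_def intro!: sum.neutral)
  then show ?thesis by simp
next
  case False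
  define P where "P = nat (n + m + l - k)"
  have k: "k = n + m + l - int P" using False by (simp add: P_def)
  have "(\<Sum>q\<in>{k-L..N+M}. Dpow' n (n + m - q) b * Dpow' q (q + l - k) c) =
        (\<Sum>q\<in>{n+m-int P..n+m}. Dpow' n (n + m - q) b * Dpow' q (q + l - k) c)"
    by (rule sum.mono_neutral_right) (use assms in \<open>auto simp: Dpow'_def k\<close>)
  also have "\<dots> = (\<Sum>j\<le>P. Dpow n j b * Dpow (n + m - int j) (P - j) c)"
    by (rule sum.reindex_bij_witness[of _ "\<lambda>j. n + m - int j" "\<lambda>q. nat (n + m - q)"])
      (auto simp: Dpow'_def k nat_diff_distrib' algebra_simps intro!: arg_cong2[where f = "(*)"] arg_cong[where f = "\<lambda>j. Dpow _ j _"])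
  also have "\<dots> = (\<Sum>i\<le>P. Dpow n (P - i) (b * Dpow m i c))"
    by (rule Dpow_assoc_aux)
  also have "\<dots> = (\<Sum>r\<in>{m+l-int P..m+l}. Dpow' n (n + r - k) (b * Dpow' m (m + l - r) c))"
    by (rule sum.reindex_bij_witness[of _ "\<lambda>r. nat (m + l - r)" "\<lambda>j. m + l - int j"])
      (auto simp: Dpow'_def k intro!: arg_cong[where f = "\<lambda>j. Dpow _ j _"])
  also have "\<dots> = (\<Sum>r\<in>{k-N..M+L}. Dpow' n (n + r - k) (b * Dpow' m (m + l - r) c))"
    by (rule sum.mono_neutral_left) (use assms in \<open>auto simp: Dpow'_def k\<close>)
  finally show ?thesis .
qed

instance
proof
  fix A B C :: "'a spdo"
  obtain N M L where N: "order_le A N" and M: "order_le B M" and L: "order_le C L" using order_le_ex by metis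
  show "A * B * C = A * (B * C)"
  proof (rule spdo_eqI)
    fix k
    define IN IM IL where "IN = {k-M-L..N}" and "IM = {k-N-L..M}" and "IL = {k-N-M..L}"
    define T where "T n m l = (coeff A n * (\<Sum>q\<in>{k-L..N+M}. Dpow' n (n + m - q) (coeff B m) * Dpow' q (q + l - k) (coeff C l)))" for n m l
    have "coeff (A * B * C) k = (\<Sum>q\<in>{k-L..N+M}. \<Sum>l\<in>IL. coeff (A * B) q * Dpow' q (q + l - k) (coeff C l))"
      unfolding IL_def by (rule coeff_mult_box) (use order_le_mult N M L in auto)
    also have "\<dots> = (\<Sum>q\<in>{k-L..N+M}. \<Sum>l\<in>IL. (\<Sum>n\<in>IN. \<Sum>m\<in>IM. coeff A n * Dpow' n (n + m - q) (coeff B m)) * Dpow' q (q + l - k) (coeff C l))"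
      unfolding IN_def IM_def 
      by (intro sum.cong refl arg_cong2[where f = "(*)"] coeff_mult_box) (use N M in auto)
    also have "\<dots> = (\<Sum>q\<in>{k-L..N+M}. \<Sum>n\<in>IN. \<Sum>m\<in>IM. \<Sum>l\<in>IL. coeff A n * (Dpow' n (n + m - q) (coeff B m) * Dpow' q (q + l - k) (coeff C l)))"
      unfolding sum_distrib_right mult.assoc
      by (intro sum.cong refl sum_rotate[symmetric])
    also have "\<dots> = (\<Sum>n\<in>IN. \<Sum>m\<in>IM. \<Sum>l\<in>IL. T n m l)"
      unfolding T_def sum_distrib_left
      by (subst sum.swap) (intro sum.cong refl sum_rotate[symmetric])
    also have "\<dots> = (\<Sum>n\<in>IN. \<Sum>m\<in>IM. \<Sum>l\<in>IL. coeff A n * (\<Sum>r\<in>{k-N..M+L}. Dpow' n (n + r - k) (coeff B m * Dpow' m (m + l - r) (coeff C l))))"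
      unfolding T_def
      by (intro sum.cong refl arg_cong2[where f = "(*)"] Dpow'_assoc) (auto simp: IN_def IM_def IL_def)
    also have "\<dots> = (\<Sum>n\<in>IN. \<Sum>r\<in>{k-N..M+L}. coeff A n * (\<Sum>m\<in>IM. \<Sum>l\<in>IL. Dpow' n (n + r - k) (coeff B m * Dpow' m (m + l - r) (coeff C l))))"
      unfolding sum_distrib_left
      by (intro sum.cong refl sum_rotate)
    also have "\<dots> = (\<Sum>n\<in>IN. \<Sum>r\<in>{k-N..M+L}. coeff A n * Dpow' n (n + r - k) (coeff (B * C) r))"
      unfolding Dpow'_sum[symmetric] IM_def IL_def
      by (intro sum.cong refl arg_cong2[where f = "(*)"] arg_cong[where f = "Dpow' _ _"] coeff_mult_box[symmetric])
        (use M L in auto)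
    also have "\<dots> = coeff (A * (B * C)) k"
      unfolding IN_def by (rule coeff_mult_box[symmetric]) (use order_le_mult N M L in auto)
    finally show "coeff (A * B * C) k = coeff (A * (B * C)) k" .
  qed
  obtain Z where Z: "N \<le> Z" "M \<le> Z" "L \<le> Z" by (meson linear max.boundedE order.trans max.cobounded1)
  have ZZ: "order_le A Z" "order_le B Z" "order_le C Z" "order_le (A + B) Z" "order_le (B + C) Z"
    using N M L Z by (auto simp: order_le_def)
  show "(A + B) * C = A * C + B * C"
    by (rule spdo_eqI, subst coeff_add)
      (simp add: ZZ coeff_mult_box[of _ Z _ Z "k - Z" k "k - Z" for k] sum.distrib distrib_right)
  show "A * (B + C) = A * B + A * C"
    by (rule spdo_eqI, subst coeff_add)
      (simp add: ZZ coeff_mult_box[of _ Z _ Z "k - Z" k "k - Z" for k] sum.distrib distrib_left Dpow'_add)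
  have one: "order_le 1 0" "coeff 1 k = (if k = 0 then 1 else 0)" for k
    by (simp_all add: order_le_def one_spdo.rep_eq)
  show "1 * A = A"
  proof (rule spdo_eqI)
    fix k
    have "coeff (1 * A) k = (\<Sum>n\<in>{min 0 (k-N)..0}. \<Sum>m\<in>{k..max k N}. coeff 1 n * Dpow' n (n + m - k) (coeff A m))"
      by (rule coeff_mult_box) (use one N in \<open>auto simp: order_le_def\<close>)
    also have "\<dots> = (\<Sum>n\<in>{0}. \<Sum>m\<in>{k}. coeff 1 n * Dpow' n (n + m - k) (coeff A m))"
      by (intro sum.mono_neutral_cong_right ballI sum.neutral) (auto simp: one Dpow'_def Dpow_exp_0)
    finally show "coeff (1 * A) k = coeff A k" by (simp add: one Dpow'_def Dpow_exp_0)
  qed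
  show "A * 1 = A"
  proof (rule spdo_eqI)
    fix k
    have "coeff (A * 1) k = (\<Sum>n\<in>{k..max k N}. \<Sum>m\<in>{min 0 (k-N)..0}. coeff A n * Dpow' n (n + m - k) (coeff 1 m))"
      by (rule coeff_mult_box) (use one N in \<open>auto simp: order_le_def\<close>)
    also have "\<dots> = (\<Sum>n\<in>{k}. \<Sum>m\<in>{0}. coeff A n * Dpow' n (n + m - k) (coeff 1 m))"
      by (intro sum.mono_neutral_cong_right ballI sum.neutral) (auto simp: one Dpow'_def Dpow_one)
    finally show "coeff (A * 1) k = coeff A k" by (simp add: one Dpow'_def Dpow_one)
  qed
  show "(0 :: 'a spdo) \<noteq> 1" by (metis one(2) coeff_0 zero_neq_one)
qed

end

lemma coeff_mult_top:
  assumes "order_le A N" "order_le B M"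
  shows "coeff (A * B) (N + M) = coeff A N * Dpow N 0 (coeff B M)"
  using coeff_mult_box[OF assms, of N "N + M" M] by (simp add: Dpow'_def)

lemma order_le_opterm: "order_le (opterm a n) n"
  by (simp add: order_le_def coeff_opterm)

lemma coeff_opterm_mult_opterm:
  "coeff (opterm a n * opterm b m) k = (if k \<le> n + m then a * Dpow n (nat (n + m - k)) b else 0)"
proof -
  have "coeff (opterm a n * opterm b m) k = (\<Sum>n'\<in>{min n (k-m)..n}. \<Sum>m'\<in>{min m (k-n)..m}.
      coeff (opterm a n) n' * Dpow' n' (n' + m' - k) (coeff (opterm b m) m'))"
    by (rule coeff_mult_box) (auto simp: order_le_opterm)
  also have "\<dots> = (\<Sum>n'\<in>{n}. \<Sum>m'\<in>{m}.
      coeff (opterm a n) n' * Dpow' n' (n' + m' - k) (coeff (opterm b m) m'))"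
    by (intro sum.mono_neutral_cong_right ballI sum.neutral) (auto simp: coeff_opterm Dpow'_def)
  finally show ?thesis by (auto simp: coeff_opterm Dpow'_def)
qed

lemma opterm_1_mult_opterm_1: "opterm 1 n * opterm 1 m = opterm 1 (n + m)"
  by (rule spdo_eqI) (auto simp: coeff_opterm_mult_opterm coeff_opterm Dpow_one)

lemma opterm_0_mult: "opterm a 0 * opterm b m = opterm (a * b) m"
  by (rule spdo_eqI) (auto simp: coeff_opterm_mult_opterm coeff_opterm Dpow_exp_0)

lemma opterm_1_0: "opterm 1 0 = 1"
  by (rule spdo_eqI) (simp add: coeff_opterm one_spdo.rep_eq)

abbreviation Dop :: "'k::field_char_0 spdo" where "Dop \<equiv> opterm 1 1"

lemma Dop_commute: "Dop * opterm a 0 = opterm (superD a) 0 + opterm (ginv a) 0 * Dop"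
proof (rule spdo_eqI)
  fix k :: int
  have *: "Dpow 1 j a = (if j = 0 then ginv a else if j = 1 then superD a else 0)" for j
  proof (cases j)
    case 0
    then show ?thesis by (simp add: Dpow_def superbinom_def)
  next
    case (Suc i)
    have "Dpow (0 + 1) (Suc i) a = ginv (Dpow 0 (Suc i) a) + superD (Dpow 0 i a)" by (rule Dpow_step_Suc)
    with Suc show ?thesis by (simp add: Dpow_exp_0)
  qed
  show "coeff (Dop * opterm a 0) k = coeff (opterm (superD a) 0 + opterm (ginv a) 0 * Dop) k"
    by (auto simp: coeff_opterm_mult_opterm coeff_opterm * Dpow_exp_0)
qed

lemma Dop_power: "Dop ^ n = opterm 1 (int n)"
  by (induction n) (simp_all add: opterm_1_0 opterm_1_mult_opterm_1)

text \<open>Since \<open>D\<close> is odd, \<open>a * D^k\<close> has the parity \<open>|a| + k\<close>.\<close>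

definition op_parity :: "bool \<Rightarrow> 'k::field_char_0 spdo \<Rightarrow> bool" where
  "op_parity p A \<longleftrightarrow> (\<forall>k. has_parity (p \<noteq> odd k) (coeff A k))"

lemma has_parity_sum: "(\<And>i. i \<in> S \<Longrightarrow> has_parity p (f i)) \<Longrightarrow> has_parity p (sum f S)"
  by (induction S rule: infinite_finite_induct) (auto intro: has_parity_0 has_parity_add)

lemma has_parity_superD: "has_parity p a \<Longrightarrow> has_parity (\<not> p) (superD a)"
  by (auto simp: has_parity_iff_ginv ginv_superD)

lemma has_parity_ginv: "has_parity p a \<Longrightarrow> has_parity p (ginv a)"
  by (simp add: has_parity_iff_ginv)

lemma has_parity_Dpow: "has_parity p a \<Longrightarrow> has_parity (p \<noteq> odd j) (Dpow n j a)"
proof -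
  assume a: "has_parity p a"
  have "has_parity (p \<noteq> odd j) ((superD ^^ j) a)"
  proof (induction j)
    case (Suc j)
    then show ?case using has_parity_superD[OF Suc] by (simp split: if_splits)
  qed (use a in simp)
  then show ?thesis unfolding Dpow_def
    using has_parity_mult[OF has_parity_scal, of "p \<noteq> odd j"] has_parity_ginv by auto
qed

lemma op_parity_mult: "op_parity p A \<Longrightarrow> op_parity q B \<Longrightarrow> op_parity (p \<noteq> q) (A * B)"
proof -
  assume A: "op_parity p A" and B: "op_parity q B"
  have "has_parity ((p \<noteq> q) \<noteq> odd k) (coeff A n * Dpow n (nat (n + m - k)) (coeff B m))" if "k \<le> n + m" for k n m
  proof -
    have "has_parity ((p \<noteq> odd n) \<noteq> ((q \<noteq> odd m) \<noteq> odd (nat (n + m - k)))) (coeff A n * Dpow n (nat (n + m - k)) (coeff B m))"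
      using A B by (intro has_parity_mult has_parity_Dpow) (simp_all add: op_parity_def)
    moreover have "((p \<noteq> odd n) \<noteq> ((q \<noteq> odd m) \<noteq> odd (nat (n + m - k)))) = ((p \<noteq> q) \<noteq> odd k)"
      using that by (auto simp: even_nat_iff)
    ultimately show ?thesis by (simp only:)
  qed
  then show ?thesis by (auto simp: op_parity_def times_spdo.rep_eq intro!: has_parity_sum)
qed

lemma op_parity_add: "op_parity p A \<Longrightarrow> op_parity p B \<Longrightarrow> op_parity p (A + B)"
  by (simp add: op_parity_def has_parity_add)

lemma op_parity_uminus: "op_parity p A \<Longrightarrow> op_parity p (- A)"
  by (simp add: op_parity_def has_parity_uminus)

lemma op_parity_opterm: "has_parity (p \<noteq> odd n) a \<Longrightarrow> op_parity p (opterm a n)"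
  by (auto simp: op_parity_def coeff_opterm has_parity_0)

definition lax :: "'k::field_char_0 spdo" where
  "lax = (Dop ^ 3 + opterm (phi 0) 0) * (Dop ^ 3 + opterm (phi 0) 0)"

definition is_lax_root :: "'k::field_char_0 spdo \<Rightarrow> bool" where
  "is_lax_root R \<longleftrightarrow> op_parity False R \<and> order_le R 2 \<and> coeff R 2 = 1 \<and> R ^ 3 = lax"

lemma op_parity_lax: "op_parity False lax"
proof -
  have "op_parity True (Dop ^ 3 + opterm (phi 0) 0 :: 'a spdo)"
    using has_parity_scal[of 1] has_parity_phi[of 0] unfolding Dop_power
    by (intro op_parity_add op_parity_opterm) auto
  from op_parity_mult[OF this this] show ?thesis by (simp add: lax_def)
qed

lemma order_le_lax: "order_le (lax :: 'k::field_char_0 spdo) 6"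
  and coeff_lax: "coeff (lax :: 'k spdo) 6 = 1"
proof -
  have o: "order_le (Dop ^ 3 + opterm (phi 0) 0 :: 'k spdo) 3"
    unfolding Dop_power by (auto simp: order_le_def coeff_opterm)
  show "order_le (lax :: 'k spdo) 6" using order_le_mult[OF o o] by (simp add: lax_def)
  show "coeff (lax :: 'k spdo) 6 = 1"
    using coeff_mult_top[OF o o] unfolding Dop_power
    by (simp add: lax_def Dop_power coeff_opterm Dpow_one)
qed

lemma cube_diff:
  fixes A E :: "'k::field_char_0 spdo"
  assumes A: "order_le A 2" "coeff A 2 = 1" and E: "order_le E N" "N \<le> 1"
  shows "order_le ((A + E) ^ 3 - A ^ 3) (N + 4)"
    and "coeff ((A + E) ^ 3 - A ^ 3) (N + 4) = scal 3 * coeff E N"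
proof -
  define B where "B = A + E"
  have B: "order_le B 2" "coeff B 2 = 1" using assms by (simp_all add: B_def order_le_def)
  have two: "order_le (X * Y) 4" "coeff (X * Y) 4 = 1" 
    if "order_le X 2" "order_le Y 2" "coeff X 2 = 1" "coeff Y 2 = 1" for X Y :: "'k spdo"
    using order_le_mult[OF that(1,2)] coeff_mult_top[OF that(1,2)] that(3,4) by (simp_all add: Dpow_one)
  have eq: "(A + E) ^ 3 - A ^ 3 = E * (B * B) + A * E * B + (A * A) * E"
    unfolding B_def by (simp add: power3_eq_cube algebra_simps)
  have D0: "Dpow 2 0 x = x" "Dpow 4 0 x = x" for x :: "'k sdp" by (simp_all add: Dpow_def superbinom_def)
  have 1: "order_le (E * (B * B)) (N + 4)" "coeff (E * (B * B)) (N + 4) = coeff E N"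
    using order_le_mult[OF E(1) two(1)[OF B(1) B(1) B(2) B(2)]] coeff_mult_top[OF E(1) two(1)[OF B(1) B(1) B(2) B(2)]]
      two(2)[OF B(1) B(1) B(2) B(2)] by (simp_all add: Dpow_one)
  have 2: "order_le (A * E) (N + 2)" "coeff (A * E) (N + 2) = coeff E N"
    using order_le_mult[OF A(1) E(1)] coeff_mult_top[OF A(1) E(1)] A(2) by (simp_all add: add.commute D0)
  have 3: "order_le (A * E * B) (N + 4)" "coeff (A * E * B) (N + 4) = coeff E N"
    using order_le_mult[OF 2(1) B(1)] coeff_mult_top[OF 2(1) B(1)] B(2) 2(2) by (simp_all add: Dpow_one add.assoc)
  have 4: "order_le (A * A * E) (N + 4)" "coeff (A * A * E) (N + 4) = coeff E N"
    using order_le_mult[OF two(1)[OF A(1) A(1) A(2) A(2)] E(1)] coeff_mult_top[OF two(1)[OF A(1) A(1) A(2) A(2)] E(1)]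
      two(2)[OF A(1) A(1) A(2) A(2)] by (simp_all add: D0 add.commute)
  show "order_le ((A + E) ^ 3 - A ^ 3) (N + 4)" unfolding eq using 1(1) 3(1) 4(1) by (simp add: order_le_def)
  have "scal (3 :: 'k) = 1 + 1 + 1" by (simp flip: scal_1 scal_add)
  then show "coeff ((A + E) ^ 3 - A ^ 3) (N + 4) = scal 3 * coeff E N" 
    unfolding eq using 1(2) 3(2) 4(2) by (simp only: coeff_add distrib_right mult_1_left)
qed

lemma scal3_cancel: "scal 3 * x = 0 \<Longrightarrow> x = (0 :: 'k::field_char_0 sdp)"
proof -
  assume "scal 3 * x = 0"
  then have "scal (1/3) * scal 3 * x = 0" by (simp add: mult.assoc)
  then show ?thesis by (simp flip: scal_mult)
qed

lemma lax_root_unique: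
  assumes "is_lax_root R" "is_lax_root S"
  shows "R = S"
proof -
  define E where "E = S - R"
  have R: "order_le R 2" "coeff R 2 = 1" and cube: "(R + E) ^ 3 - R ^ 3 = 0"
    using assms by (simp_all add: is_lax_root_def E_def)
  have "order_le E (1 - int m)" for m
  proof (induction m)
    case 0
    have "coeff E k = 0" if "k > 1" for k
      using assms that by (cases "k = 2") (auto simp: is_lax_root_def E_def order_le_def)
    then show ?case by (simp add: order_le_def)
  next
    case (Suc m)
    have "coeff E (1 - int m) = 0"
      using cube_diff(2)[OF R Suc] cube scal3_cancel by simp
    then have "coeff E k = 0" if "k > 1 - int (Suc m)" for k
      using that Suc by (cases "k = 1 - int m") (auto simp: order_le_def)
    then show ?case by (simp add: order_le_def)
  qed
  note order_le_E = this
  have "coeff E k = 0" for k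
    using order_le_E[of "nat (2 - k)"] by (cases "k \<le> 2") (auto simp: order_le_def)
  then have "E = 0" by (intro spdo_eqI) simp
  then show ?thesis by (simp add: E_def)
qed

lemma order_le_step: "order_le A N \<Longrightarrow> coeff A N = 0 \<Longrightarrow> order_le A (N - 1)"
  unfolding order_le_def by (metis linorder_neqE zle_diff1_eq not_le)

primrec approx :: "nat \<Rightarrow> 'k::field_char_0 spdo" where
  "approx 0 = opterm 1 2"
| "approx (Suc m) = approx m + opterm (scal (1/3) * coeff (lax - approx m ^ 3) (5 - int m)) (1 - int m)"

lemma approx_props:
  "op_parity False (approx m :: 'k::field_char_0 spdo) \<and> order_le (approx m :: 'k spdo) 2 \<and>
   coeff (approx m :: 'k spdo) 2 = 1 \<and> order_le (lax - approx m ^ 3 :: 'k spdo) (5 - int m)"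
proof (induction m)
  case 0
  have o: "order_le (opterm 1 2 :: 'k spdo) 2" by (rule order_le_opterm)
  have "opterm 1 2 ^ 3 = (opterm 1 6 :: 'k spdo)" by (simp add: power3_eq_cube opterm_1_mult_opterm_1)
  moreover have "order_le (lax - opterm 1 6 :: 'k spdo) 5"
  proof -
    have "coeff (lax - opterm 1 6 :: 'k spdo) k = 0" if "k > 5" for k
      using that order_le_lax[where ?'k = 'k] coeff_lax[where ?'k = 'k]
      by (cases "k = 6") (auto simp: order_le_def coeff_opterm)
    then show ?thesis by (simp add: order_le_def)
  qed
  ultimately show ?case using o has_parity_scal[of 1] by (auto simp: coeff_opterm intro!: op_parity_opterm)
next
  case (Suc m)
  let ?A = "approx m :: 'k spdo"
  let ?c = "scal (1/3) * coeff (lax - ?A ^ 3) (5 - int m)"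
  let ?E = "opterm ?c (1 - int m)"
  have A: "op_parity False ?A" "order_le ?A 2" "coeff ?A 2 = 1" "order_le (lax - ?A ^ 3) (5 - int m)"
    using Suc by auto
  have "op_parity False (lax - ?A ^ 3)"
    using op_parity_mult[OF A(1) op_parity_mult[OF A(1) A(1)]] op_parity_add[OF op_parity_lax op_parity_uminus]
    by (simp add: power3_eq_cube mult.assoc)
  then have "has_parity (odd (5 - int m)) (coeff (lax - ?A ^ 3) (5 - int m))"
    unfolding op_parity_def by (metis (full_types))
  then have "op_parity False ?E"
    using has_parity_mult[OF has_parity_scal] by (intro op_parity_opterm) fastforce
  then have 1: "op_parity False (approx (Suc m) :: 'k spdo)" using A(1) op_parity_add by (simp del: coeff_diff)
  have 2: "order_le (approx (Suc m) :: 'k spdo) 2" "coeff (approx (Suc m) :: 'k spdo) 2 = 1"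
    using A by (auto simp: order_le_def coeff_opterm)
  have E: "order_le ?E (1 - int m)" "1 - int m \<le> 1" by (simp_all only: order_le_opterm)
  note cd = cube_diff[OF A(2,3) E]
  have eq: "lax - approx (Suc m) ^ 3 = (lax - ?A ^ 3) - ((?A + ?E) ^ 3 - ?A ^ 3)" by simp
  have "scal 3 * coeff ?E (1 - int m) = coeff (lax - ?A ^ 3) (5 - int m)"
    unfolding coeff_opterm by (simp flip: mult.assoc scal_mult)
  then have "coeff (lax - approx (Suc m) ^ 3 :: 'k spdo) (5 - int m) = 0"
    unfolding eq coeff_diff[of "lax - _"] using cd(2) by (simp del: coeff_diff)
  moreover have "order_le (lax - approx (Suc m) ^ 3 :: 'k spdo) (5 - int m)"
    unfolding eq using A(4) cd(1) unfolding order_le_def coeff_diff[of "lax - _"] by (simp del: coeff_diff)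
  ultimately have "order_le (lax - approx (Suc m) ^ 3 :: 'k spdo) (5 - int m - 1)"
    by (intro order_le_step)
  moreover have "5 - int m - 1 = 5 - int (Suc m)" by simp
  ultimately have "order_le (lax - approx (Suc m) ^ 3 :: 'k spdo) (5 - int (Suc m))"
    by (simp only:)
  then show ?case using 1 2 by blast
qed

lemma approx_stable: "coeff (approx (m + d)) k = coeff (approx m :: 'k::field_char_0 spdo) k" if "1 - int m < k"
  using that by (induction d) (auto simp: coeff_opterm)

lemma lax_root_exists: "\<exists>R :: 'k::field_char_0 spdo. is_lax_root R"
proof -
  define r where "r k = coeff (approx (nat (2 - k)) :: 'k spdo) k" for k
  define R where "R = Abs_spdo r"
  have r: "r k = coeff (approx m) k" if "1 - int m < k" for k m
  proof -
    have "nat (2 - k) \<le> m" using that by simp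
    then obtain d where "m = nat (2 - k) + d" using le_Suc_ex by blast
    then show ?thesis unfolding r_def by (simp add: approx_stable)
  qed
  have "\<forall>k>2. r k = 0" using r[of 0] approx_props[of 0, where ?'k = 'k] by (simp add: coeff_opterm)
  then have R: "coeff R k = r k" for k unfolding R_def by (subst Abs_spdo_inverse) blast+
  have lt: "order_le R 2" "coeff R 2 = 1"
    using \<open>\<forall>k>2. r k = 0\<close> r[of 0 2] by (simp_all add: R order_le_def coeff_opterm)
  moreover have "op_parity False (approx m :: 'k spdo)" for m using approx_props by blast
  then have "op_parity False R" by (simp add: op_parity_def R r_def)
  moreover have "coeff (lax - R ^ 3) k = 0" for k
  proof -
    define m where "m = nat (6 - k)"
    have o: "order_le (R - approx m) (1 - int m)" by (simp add: order_le_def R r)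
    note A = approx_props[of m, where ?'k = 'k]
    have "order_le ((approx m + (R - approx m)) ^ 3 - approx m ^ 3) (1 - int m + 4)"
      by (rule cube_diff(1)) (use A o in auto)
    then have "order_le (lax - R ^ 3) (5 - int m)"
      using A by (simp add: order_le_def)
    then show ?thesis by (simp add: order_le_def m_def)
  qed
  then have "lax - R ^ 3 = 0" by (intro spdo_eqI) simp
  ultimately show ?thesis unfolding is_lax_root_def by (intro exI[of _ R]) simp
qed

lemma lax_root_ex1: "\<exists>!R :: 'k::field_char_0 spdo. is_lax_root R"
  using lax_root_exists lax_root_unique by blast

definition lax_root :: "'k::field_char_0 spdo" where
  "lax_root = (THE R. is_lax_root R)"

definition sres :: "'k::field_char_0 spdo \<Rightarrow> 'k sdp" where
  "sres A = coeff A (-1)"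

end

theory Submission
  imports Defs
begin

text \<open>
  Put \<open>S = D^3 + \<phi>\<close>, so that \<open>L = S^2\<close>, and \<open>R = L^(1/3)\<close>. Comparing leading coefficients shows
  that everything commuting with \<open>R^3\<close> commutes with \<open>R\<close>; in particular \<open>S\<close> does. Hence
  \<open>R^(m+3) = S B\<close> with \<open>B = S R^m\<close> odd and \<open>S B = B S\<close>, so that \<open>2 R^(m+3)\<close> is the supercommutator
  \<open>S B + B S\<close> of odd operators, whose super residue is a super derivative. The exponents 1 and 2
  are treated by computing the first coefficients of \<open>R\<close>.
\<close>

section \<open>The square root of \<open>lax\<close>, parity and scalars\<close>

definition sqrt_lax :: "'k::field_char_0 spdo" where
  "sqrt_lax = opterm 1 3 + opterm (phi 0) 0"

lemma lax_eq_square: "lax = sqrt_lax * sqrt_lax"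
  by (simp add: lax_def sqrt_lax_def Dop_power)

lemma op_parity_sqrt_lax: "op_parity True sqrt_lax"
  using has_parity_scal[of 1] has_parity_phi[of 0] unfolding sqrt_lax_def
  by (intro op_parity_add op_parity_opterm) auto

lemma op_parity_power: "op_parity False A \<Longrightarrow> op_parity False (A ^ n)"
proof (induction n)
  case 0
  then show ?case
    using has_parity_scal[of 1] by (auto simp flip: opterm_1_0 intro!: op_parity_opterm)
next
  case (Suc n)
  then show ?case using op_parity_mult[of False A False "A ^ n"] by simp
qed

lemma range_superD_scal: "a \<in> range superD \<Longrightarrow> scal c * a \<in> range superD"
proof (elim rangeE)
  fix f assume "a = superD f"
  then have "scal c * a = superD (scal c * f)" by simp
  then show ?thesis by blast
qed

lemma scal_of_nat: "scal (of_nat n) = of_nat n"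
  by (induction n) (simp_all add: scal_add)

text \<open>Division by an integer passes through the scalars, where characteristic zero makes it
  possible.\<close>

lemma of_nat_mult_eq_imp:
  fixes x y :: "'k::field_char_0 sdp"
  assumes "n > 0" "of_nat n * x = y"
  shows "x = scal (1 / of_nat n) * y"
proof -
  have "scal (1 / of_nat n) * y = scal (1 / of_nat n * of_nat n) * x"
    unfolding scal_mult scal_of_nat assms(2)[symmetric] by (rule mult.assoc[symmetric])
  then show ?thesis using assms(1) by simp
qed

lemma of_nat_3_mult: "of_nat 3 * x = x + x + (x :: 'a::semiring_1)"
  by (simp only: numeral_Bit1 numeral_One of_nat_add of_nat_1 distrib_right mult_1_left)

text \<open>Stated with \<open>ginv\<close>, the sign rule for the odd \<open>phi 0\<close> also
  holds for inhomogeneous \<open>a\<close>.\<close>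

lemma phi_0_mult: "phi 0 * a = ginv a * phi 0"
proof (induction a rule: sdp_induct)
  case (phi k)
  show ?case using phi_supercomm[of 0 k, where ?'a = 'a] by (simp add: mult.assoc)
next
  case (mult a b)
  have "phi 0 * (a * b) = ginv a * (phi 0 * b)" using mult.IH(1) by (metis mult.assoc)
  then show ?case using mult.IH(2) by (simp add: mult.assoc)
qed (simp_all add: scal_central algebra_simps)

section \<open>Coefficients of products with elementary operators\<close>

lemma coeff_mult_opterm_1: "coeff (A * opterm 1 m) k = coeff A (k - m)"
proof -
  obtain N where N: "order_le A N" using order_le_ex by blast
  \<comment> \<open>The \<open>max\<close> and \<open>min\<close> keep the one surviving pair
    \<open>(k - m, m)\<close> in the box even if \<open>A\<close> has order below
    \<open>k - m\<close>.\<close>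
  have "coeff (A * opterm 1 m) k = (\<Sum>n\<in>{k-m..max N (k-m)}. \<Sum>m'\<in>{min m (k - max N (k-m))..m}.
      coeff A n * Dpow' n (n + m' - k) (coeff (opterm 1 m) m'))"
    by (rule coeff_mult_box) (use order_le_mono[OF N] order_le_opterm in auto)
  also have "\<dots> = (\<Sum>n\<in>{k-m}. \<Sum>m'\<in>{m}. coeff A n * Dpow' n (n + m' - k) (coeff (opterm 1 m) m'))"
    by (intro sum.mono_neutral_cong_right ballI sum.neutral)
      (auto simp: coeff_opterm Dpow'_def Dpow_one)
  finally show ?thesis by (simp add: coeff_opterm Dpow'_def Dpow_one)
qed

lemma coeff_opterm_0_mult: "coeff (opterm a 0 * A) k = a * coeff A k"
proof -
  obtain N where N: "order_le A N" using order_le_ex by blast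
  have "coeff (opterm a 0 * A) k = (\<Sum>n\<in>{min 0 (k - max N k)..0}. \<Sum>m\<in>{k..max N k}.
      coeff (opterm a 0) n * Dpow' n (n + m - k) (coeff A m))"
    by (rule coeff_mult_box) (use order_le_mono[OF N] order_le_opterm in auto)
  also have "\<dots> = (\<Sum>n\<in>{0}. \<Sum>m\<in>{k}. coeff (opterm a 0) n * Dpow' n (n + m - k) (coeff A m))"
    by (intro sum.mono_neutral_cong_right ballI sum.neutral)
      (auto simp: coeff_opterm Dpow'_def Dpow_exp_0)
  finally show ?thesis by (simp add: coeff_opterm Dpow'_def Dpow_exp_0)
qed

lemma coeff_Dop_mult: "coeff (Dop * A) k = superD (coeff A k) + ginv (coeff A (k - 1))"
proof -
  have D: "Dpow 1 0 c = ginv c" "Dpow 1 1 c = superD c" "j > 1 \<Longrightarrow> Dpow 1 j c = 0" for c :: "'a sdp" and j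
    using Dpow_step_0[of 0 c] Dpow_step_Suc[of 0 _ c]
    by (auto simp: Dpow_exp_0 elim: less_natE)
  obtain N where N: "order_le A N" using order_le_ex by blast
  have "coeff (Dop * A) k = (\<Sum>n\<in>{min 1 (k - max N k)..1}. \<Sum>m\<in>{k-1..max N k}.
      coeff Dop n * Dpow' n (n + m - k) (coeff A m))"
    by (rule coeff_mult_box) (use order_le_mono[OF N] order_le_opterm in auto)
  also have "\<dots> = (\<Sum>n\<in>{1}. \<Sum>m\<in>{k-1,k}. coeff Dop n * Dpow' n (n + m - k) (coeff A m))"
    by (intro sum.mono_neutral_cong_right ballI sum.neutral)
      (auto simp: coeff_opterm Dpow'_def D(3))
  finally show ?thesis using D(2)[of "coeff A k"] by (simp add: coeff_opterm Dpow'_def D(1) add.commute)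
qed

text \<open>Applying \<open>coeff_Dop_mult\<close> twice, the two terms in
  \<open>coeff A (k - 1)\<close> cancel because \<open>ginv\<close> anticommutes with
  \<open>superD\<close>.\<close>

lemma coeff_D2_mult: "coeff (opterm 1 2 * A) k = superD (superD (coeff A k)) + coeff A (k - 2)"
proof -
  have "opterm 1 2 * A = Dop * (Dop * A)"
    by (simp add: opterm_1_mult_opterm_1 flip: mult.assoc)
  then show ?thesis by (simp add: coeff_Dop_mult ginv_superD)
qed

lemma opterm_1_3_mult: "opterm 1 3 * A = Dop * (opterm 1 2 * A)"
  by (simp add: opterm_1_mult_opterm_1 flip: mult.assoc)

text \<open>For \<open>m \<ge> 0\<close> the operator \<open>D^m a\<close> is differential, so only the coefficient of \<open>D^(-1)\<close> in \<open>A\<close> contributes.\<close>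

lemma coeff_mult_opterm_0: "coeff (A * opterm a 0) (-1) = coeff A (-1) * ginv a"
proof -
  \<comment> \<open>For even \<open>m\<close> the index \<open>m + 1\<close> is odd, so
    \<open>superbinom\<close> is zero; for \<open>m = 2 q + 1\<close> it is \<open>q\<close> choose
    \<open>q + 1\<close>, again zero.\<close>
  have D: "Dpow m (nat (m + 1)) a = 0" if "m \<ge> 0" for m
  proof (cases "even m")
    case True
    then show ?thesis using that by (simp add: Dpow_def superbinom_def even_nat_iff)
  next
    case False
    then obtain p where p: "m = 2 * p + 1" by (elim oddE)
    define q where "q = nat p"
    have "m = 2 * int q + 1" using that p by (simp add: q_def)
    moreover have "nat (2 + 2 * int q) = 2 * Suc q" by simp
    moreover have "of_nat q gchoose Suc q = (0 :: 'a)"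
      by (simp flip: binomial_gbinomial)
    ultimately show ?thesis by (simp add: Dpow_def superbinom_def del: gbinomial_Suc)
  qed
  obtain N where N: "order_le A N" using order_le_ex by blast
  have "coeff (A * opterm a 0) (-1) = (\<Sum>n\<in>{-1..max N (-1)}. \<Sum>m\<in>{min 0 (- 1 - max N (-1))..0}.
      coeff A n * Dpow' n (n + m - (-1)) (coeff (opterm a 0) m))"
    by (rule coeff_mult_box) (use order_le_mono[OF N] order_le_opterm in auto)
  also have "\<dots> = (\<Sum>n\<in>{-1}. \<Sum>m\<in>{0}. coeff A n * Dpow' n (n + m - (-1)) (coeff (opterm a 0) m))"
    by (intro sum.mono_neutral_cong_right ballI sum.neutral)
      (auto simp: coeff_opterm Dpow'_def D)
  finally show ?thesis
    using Dpow_step_0[of "-1" a] by (simp add: coeff_opterm Dpow'_def Dpow_exp_0) (metis ginv_ginv)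
qed

section \<open>Super residue of a supercommutator\<close>

text \<open>Write \<open>b k\<close> for \<open>coeff B k\<close>. As \<open>B\<close> is odd,
  \<open>b (-4)\<close> is odd and \<open>b (-1)\<close> even. So the underived terms
  \<open>ginv (b (-4)) + b (-4)\<close> of \<open>D^3 B + B D^3\<close> cancel, as do the
  contributions of \<open>phi 0\<close>; every other term is a super derivative.\<close>

lemma sres_supercommutator_sqrt_lax:
  fixes B :: "'k::field_char_0 spdo"
  assumes "op_parity True B"
  shows "sres (sqrt_lax * B + B * sqrt_lax) \<in> range superD"
proof -
  let ?b = "coeff B"
  have "has_parity (True \<noteq> odd k) (?b k)" for k
    using assms by (simp only: op_parity_def)
  from ginv_has_parity[OF this[of "-4"]] ginv_has_parity[OF this[of "-1"]]
  have "ginv (?b (-4)) = - ?b (-4)" "ginv (?b (-1)) = ?b (-1)" by simp_all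
  then have "sres (sqrt_lax * B + B * sqrt_lax)
      = superD (superD (superD (?b (-1))) + ?b (-3) + superD (ginv (?b (-2))))"
    by (simp add: sres_def sqrt_lax_def distrib_left distrib_right opterm_1_3_mult coeff_Dop_mult
        coeff_D2_mult coeff_mult_opterm_1 coeff_opterm_0_mult coeff_mult_opterm_0 phi_0_mult ginv_superD)
  then show ?thesis by blast
qed

section \<open>Operators commuting with a cube\<close>

text \<open>For the commutator \<open>C\<close> of \<open>X\<close> and \<open>A\<close>, that of
  \<open>X\<close> and \<open>A ^ 3\<close> is \<open>C A A + A C A + A A C\<close>. If
  \<open>C\<close> has order at most \<open>N\<close>, its coefficient in degree
  \<open>N + 4\<close> is three times \<open>coeff C N\<close>. Hence the order of \<open>C\<close>
  can be lowered forever.\<close>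

lemma commute_if_commute_cube:
  fixes A X :: "'k::field_char_0 spdo"
  assumes A: "order_le A 2" "coeff A 2 = 1" and comm: "X * A ^ 3 = A ^ 3 * X"
  shows "X * A = A * X"
proof -
  define C where "C = X * A - A * X"
  have "C * A * A + A * C * A + A * (A * C) = X * A ^ 3 - A ^ 3 * X"
    by (simp add: C_def power3_eq_cube algebra_simps)
  then have sum0: "C * A * A + A * C * A + A * (A * C) = 0" using comm by simp
  have right: "order_le (E * A) (N + 2)" "coeff (E * A) (N + 2) = coeff E N" if "order_le E N" for E N
    using order_le_mult[OF that A(1)] coeff_mult_top[OF that A(1)] A(2) by (simp_all add: Dpow_one)
  \<comment> \<open>No \<open>ginv\<close> appears, since the order 2 of \<open>A\<close> is
    even.\<close>
  have left: "order_le (A * E) (N + 2)" "coeff (A * E) (N + 2) = coeff E N" if "order_le E N" for E N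
    using order_le_mult[OF A(1) that] coeff_mult_top[OF A(1) that] A(2)
    by (simp_all add: add.commute Dpow_def superbinom_def)
  have step: "order_le C (N - 1)" if N: "order_le C N" for N
  proof -
    have "coeff (C * A * A + A * C * A + A * (A * C)) (N + 2 + 2) = coeff C N + coeff C N + coeff C N"
      using N by (simp only: coeff_add right left)
    then have "of_nat 3 * coeff C N = 0" using sum0
      by (simp add: of_nat_3_mult del: of_nat_numeral)
    from of_nat_mult_eq_imp[OF _ this] have "coeff C N = 0" by simp
    with N show ?thesis by (rule order_le_step)
  qed
  obtain N where N: "order_le C N" using order_le_ex by blast
  have "order_le C (N - int m)" for m
  proof (induction m)
    case (Suc m)
    then show ?case using step[OF Suc] by (simp add: algebra_simps)
  qed (use N in simp)
  then have *: "order_le C (N - int m)" for m .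
  have "coeff C k = 0" for k
    using *[of "nat (N + 1 - k)"] N by (cases "k \<le> N") (auto simp: order_le_def)
  then have "C = 0" by (intro spdo_eqI) simp
  then show ?thesis by (simp add: C_def)
qed

section \<open>First coefficients of the root\<close>

text \<open>Oddness of \<open>phi 0\<close> makes its square vanish and cancels the
  \<open>D^3\<close> term of \<open>D^3 phi 0\<close> against \<open>phi 0 D^3\<close>.\<close>

lemma coeff_lax_eq: "coeff (lax :: 'k::field_char_0 spdo) k =
  (if k = 6 then 1 else if k = 2 then phi 1 else if k = 1 then - phi 2 else if k = 0 then phi 3 else 0)"
proof -
  have "phi 0 * phi 0 + phi 0 * phi 0 = (0 :: 'k sdp)"
    by (subst (1) phi_0_mult) simp
  then have sq: "phi 0 * phi 0 = (0 :: 'k sdp)" by (rule scal_half)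
  have D3: "coeff (opterm 1 3 * opterm (phi 0) 0 :: 'k spdo) k = (if k = 3 then - phi 0
      else if k = 2 then phi 1 else if k = 1 then - phi 2 else if k = 0 then phi 3 else 0)"
  proof -
    consider "k = 0" | "k = 1" | "k = 2" | "k = 3" | "k \<notin> {0, 1, 2, 3}" by blast
    then show ?thesis
      by cases (auto simp: opterm_1_3_mult coeff_Dop_mult coeff_D2_mult coeff_opterm eval_nat_numeral)
  qed
  have lax: "lax = opterm 1 6 + opterm 1 3 * opterm (phi 0) 0 + opterm (phi 0 :: 'k sdp) 3 + opterm 0 0"
    by (simp add: lax_eq_square sqrt_lax_def distrib_left distrib_right opterm_1_mult_opterm_1
        opterm_0_mult sq add.assoc)
  show ?thesis unfolding lax by (simp add: D3 coeff_opterm)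
qed

text \<open>By \<open>cube_diff\<close>, a leading term of the tail in degree \<open>N\<close> would
  appear tripled in degree \<open>N + 4\<close> of \<open>lax\<close>, which has no terms in degrees
  5, 4, 3.\<close>

lemma lax_root_order_le_tail:
  fixes R :: "'k::field_char_0 spdo"
  assumes R: "is_lax_root R"
  shows "order_le (R - opterm 1 2) (-2)"
proof -
  let ?S = "opterm 1 2 :: 'k spdo" and ?E = "R - opterm 1 2"
  have S: "order_le ?S 2" "coeff ?S 2 = 1" by (simp_all add: order_le_opterm coeff_opterm)
  have cube: "(?S + ?E) ^ 3 - ?S ^ 3 = lax - opterm 1 6"
    using R by (simp add: is_lax_root_def power3_eq_cube opterm_1_mult_opterm_1)
  have step: "order_le ?E (N - 1)" if "order_le ?E N" "N \<in> {-1, 0, 1}" for N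
  proof -
    have "coeff (lax - opterm 1 6 :: 'k spdo) (N + 4) = scal 3 * coeff ?E N"
      using cube_diff(2)[OF S that(1)] that(2) unfolding cube by auto
    moreover have "coeff (lax - opterm 1 6 :: 'k spdo) (N + 4) = 0"
      using that(2) by (auto simp: coeff_lax_eq coeff_opterm)
    ultimately have "coeff ?E N = 0" using scal3_cancel by metis
    with that(1) show ?thesis by (rule order_le_step)
  qed
  have "order_le ?E 2" "coeff ?E 2 = 0"
    using R S by (simp_all add: is_lax_root_def order_le_def)
  then have "order_le ?E 1" using order_le_step[of ?E 2] by simp
  from step[OF this] have "order_le ?E 0" by simp
  from step[OF this] have "order_le ?E (-1)" by simp
  from step[OF this] show ?thesis by simp
qed

lemma sres_lax_root: "is_lax_root R \<Longrightarrow> sres R = 0"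
  using lax_root_order_le_tail[of R] by (simp add: order_le_def sres_def coeff_opterm)

text \<open>With \<open>R = D^2 + E\<close>, the residue is twice the \<open>D^(-3)\<close>
  coefficient of \<open>E\<close>. The \<open>D\<close> coefficient of \<open>R ^ 3 = lax\<close>
  determines it as \<open>- phi 2 / 3\<close>, and \<open>phi 2\<close> is
  \<open>superD (phi 1)\<close>.\<close>

lemma sres_lax_root_square:
  fixes R :: "'k::field_char_0 spdo"
  assumes R: "is_lax_root R"
  shows "sres (R ^ 2) \<in> range superD"
proof -
  define S E where "S = (opterm 1 2 :: 'k spdo)" and "E = R - S"
  have E: "order_le E (-2)" using lax_root_order_le_tail[OF R] by (simp add: E_def S_def)
  have S2: "order_le S 2" by (simp add: S_def order_le_opterm)
  have R2: "order_le R 2" using R by (simp add: is_lax_root_def)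
  have o: "order_le (E * E) (-4)" "order_le (E * E * R) (-2)" "order_le (E * (S * E)) (-2)"
    "order_le (S * (E * E)) (-2)"
    using order_le_mult[OF E E] order_le_mult[OF order_le_mult[OF E E] R2]
      order_le_mult[OF E order_le_mult[OF S2 E]] order_le_mult[OF S2 order_le_mult[OF E E]] by simp_all
  have "R ^ 2 = S * S + (S * E + E * S) + E * E"
    by (simp add: E_def power2_eq_square algebra_simps)
  then have "sres (R ^ 2) = of_nat 2 * coeff E (-3)"
    using o(1) E by (simp add: sres_def S_def opterm_1_mult_opterm_1 coeff_opterm coeff_D2_mult
        coeff_mult_opterm_1 order_le_def mult_2)
  moreover have "coeff E (-3) = scal (1 / of_nat 3) * (- phi 2)"
  proof (rule of_nat_mult_eq_imp)
    \<comment> \<open>The last group collects all terms of degree at least two in \<open>E\<close>;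
      its order is at most -2, so it misses degree 1.\<close>
    have "R ^ 3 = S * S * S + (S * (S * E) + S * E * S + E * (S * S)) + (E * E * R + E * (S * E) + S * (E * E))"
      by (simp add: E_def power3_eq_cube algebra_simps)
    moreover have "coeff (R ^ 3) 1 = - phi 2"
      using R by (simp add: is_lax_root_def coeff_lax_eq)
    moreover have "coeff (E * E * R + E * (S * E) + S * (E * E)) 1 = 0"
      using o by (simp add: order_le_def)
    ultimately have "coeff (S * S * S + (S * (S * E) + S * E * S + E * (S * S))) 1 = - phi 2"
      by (metis coeff_add add.right_neutral)
    then show "of_nat 3 * coeff E (-3) = - phi 2"
      using E by (simp add: S_def opterm_1_mult_opterm_1 coeff_opterm coeff_D2_mult
        coeff_mult_opterm_1 order_le_def of_nat_3_mult del: of_nat_numeral)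
  qed simp
  moreover have "- phi 2 = superD (- phi 1 :: 'k sdp)" by (simp add: numeral_2_eq_2)
  ultimately show ?thesis
    using range_superD_scal[of _ "of_nat 2"] range_superD_scal by (metis rangeI scal_of_nat)
qed

theorem proposition1:
  fixes n :: nat
  assumes "n > 0"
  shows "sres ((lax_root :: 'k::field_char_0 spdo) ^ n) \<in> range superD"
proof -
  let ?R = "lax_root :: 'k spdo" and ?S = "sqrt_lax :: 'k spdo"
  have R: "is_lax_root ?R" unfolding lax_root_def by (rule theI'[OF lax_root_ex1])
  show ?thesis
  proof (cases "n < 3")
    case True
    with assms have "n = 1 \<or> n = 2" by auto
    moreover have "0 \<in> range (superD :: 'k sdp \<Rightarrow> _)" by (metis rangeI superD_0)
    ultimately show ?thesis using sres_lax_root[OF R] sres_lax_root_square[OF R] by auto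
  next
    case False
    \<comment> \<open>An exponent of at least 3 lets \<open>R ^ 3 = S * S\<close> be split off,
      leaving a nonnegative power of \<open>R\<close>.\<close>
    then obtain m where n: "n = 3 + m" using le_Suc_ex not_less by blast
    define B where "B = ?S * ?R ^ m"
    have cube: "?R ^ 3 = ?S * ?S" using R by (simp add: is_lax_root_def lax_eq_square)
    have "?S * ?R = ?R * ?S"
    proof (rule commute_if_commute_cube)
      show "order_le ?R 2" "coeff ?R 2 = 1" using R by (simp_all add: is_lax_root_def)
      show "?S * ?R ^ 3 = ?R ^ 3 * ?S" by (simp only: cube mult.assoc)
    qed
    then have "?S * ?R ^ m = ?R ^ m * ?S" by (metis power_commuting_commutes)
    then have "B * ?S = ?S * B" by (metis B_def mult.assoc)
    moreover have "?R ^ n = ?S * B" by (simp add: n power_add cube B_def mult.assoc)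
    ultimately have "of_nat 2 * sres (?R ^ n) = sres (?S * B + B * ?S)"
      by (simp add: sres_def mult_2)
    then have "sres (?R ^ n) = scal (1 / of_nat 2) * sres (?S * B + B * ?S)"
      by (rule of_nat_mult_eq_imp[rotated]) simp
    moreover have "op_parity True B"
      using op_parity_mult[OF op_parity_sqrt_lax op_parity_power[of ?R m]] R
      by (simp add: B_def is_lax_root_def)
    ultimately show ?thesis
      using sres_supercommutator_sqrt_lax range_superD_scal by metis
  qed
qed

end
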